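(* Fix a dimension $d\ge1$ and a constant $c\ge 1$. The intersection graph of any $n$ objects in $\mathbb{R}^d$ forming a $c$-fat collection admits a $3$-hop spanner of size $O(n\log n)$, where the constant in the $O(\cdot)$ depends only on $d$ and $c$.
   Context: Objects are bounded subsets of $\mathbb{R}^d$. The side length of an object is the side length of its smallest enclosing axis-aligned hypercube. A collection of objects is $c$-fat if for every axis-aligned hypercube $\gamma$ with side length $\ell$, there exist $c$ points that together hit (i.e., lie in) all objects of the collection that intersect $\gamma$ and have side length at least $\ell$. The intersection graph has the objects as vertices, with an edge between two objects iff they intersect. For a graph $G$ and integer $t\ge1$, a $t$-hop spanner is a subgraph $\widehat{G}$ of $G$ on the same vertex set such that for every edge $uv\in E(G)$ there is a $u$–$v$ path in $\widehat{G}$ with at most $t$ edges; its size is its number of edges. *)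

theory Defs
  imports "HOL-Analysis.Analysis"
begin

text \<open>Side length of an object: side length of its smallest enclosing axis-aligned
  hypercube, i.e. the largest coordinate extent.\<close>
definition side_length :: "(real ^ 'd) set \<Rightarrow> real" where
  "side_length S = Max (range (\<lambda>i::'d. (SUP x\<in>S. x $ i) - (INF x\<in>S. x $ i)))"

definition hypercube :: "real ^ 'd \<Rightarrow> real \<Rightarrow> (real ^ 'd) set" where
  "hypercube a l = {x. \<forall>i. a $ i \<le> x $ i \<and> x $ i \<le> a $ i + l}"

definition c_fat :: "nat \<Rightarrow> 'v set \<Rightarrow> ('v \<Rightarrow> (real ^ 'd) set) \<Rightarrow> bool" where
  "c_fat c V Obj \<longleftrightarrow>
     (\<forall>a l. l \<ge> 0 \<longrightarrow>
        (\<exists>P. finite P \<and> card P \<le> c \<and>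
             (\<forall>v\<in>V. Obj v \<inter> hypercube a l \<noteq> {} \<and> side_length (Obj v) \<ge> l
                     \<longrightarrow> P \<inter> Obj v \<noteq> {})))"

definition intersection_graph :: "'v set \<Rightarrow> ('v \<Rightarrow> 'a set) \<Rightarrow> 'v set set" where
  "intersection_graph V Obj = {{u, v} | u v. u \<in> V \<and> v \<in> V \<and> u \<noteq> v \<and> Obj u \<inter> Obj v \<noteq> {}}"

definition hop_reachable :: "'v set set \<Rightarrow> nat \<Rightarrow> 'v \<Rightarrow> 'v \<Rightarrow> bool" where
  "hop_reachable H t u v \<longleftrightarrow>
     (\<exists>ps. ps \<noteq> [] \<and> length ps \<le> t + 1 \<and> hd ps = u \<and> last ps = v \<and>
           (\<forall>i. Suc i < length ps \<longrightarrow> {ps ! i, ps ! Suc i} \<in> H))"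

definition hop_spanner :: "'v set set \<Rightarrow> 'v set set \<Rightarrow> nat \<Rightarrow> bool" where
  "hop_spanner E H t \<longleftrightarrow> H \<subseteq> E \<and> (\<forall>u v. {u, v} \<in> E \<longrightarrow> hop_reachable H t u v)"

end

theory Submission
  imports Defs
begin

text \<open>Replace each object by copies of it in the at most \<open>3 ^ d\<close> dyadic cells that it meets and
  whose size is comparable to its own (an object that is a single point gets the cell consisting of
  that point). The cells form a laminar family, and a point common to two objects \<open>u\<close>, \<open>v\<close> lies in a
  cell of \<open>u\<close> and in a cell of \<open>v\<close>, which are therefore nested. If \<open>A \<subseteq> X \<subseteq> B\<close> are cells, \<open>u\<close> belongs
  to \<open>A\<close>, \<open>v\<close> belongs to \<open>B\<close>, and the two objects meet inside \<open>A\<close>, then \<open>v\<close> meets \<open>X\<close> and is at least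
  as large as \<open>X\<close>, so \<open>v\<close> contains one of the \<open>c\<close> points \<open>p\<close> that fatness provides for \<open>X\<close>. Hence a
  star on the objects containing \<open>p\<close>, together with one edge from \<open>u\<close> to some object containing \<open>p\<close>,
  gives a path of three edges from \<open>u\<close> to \<open>v\<close>. Taking for \<open>X\<close> balanced separators of the forest of
  cells, all edges are served after logarithmically many rounds with at most \<open>2 c\<close> new edges per
  copy each.\<close>

section \<open>Short paths and edges of the intersection graph\<close>

text \<open>Each hop may stand still, so coincidences such as an object being its own hub need no
  separate path.\<close>

definition three_hops :: "'v set set \<Rightarrow> 'v \<Rightarrow> 'v \<Rightarrow> bool" where
  "three_hops H u v \<longleftrightarrow>
     (\<exists>x y. (u = x \<or> {u, x} \<in> H) \<and> (x = y \<or> {x, y} \<in> H) \<and> (y = v \<or> {y, v} \<in> H))"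

lemma three_hops_sym: "three_hops H u v \<Longrightarrow> three_hops H v u"
proof -
  assume "three_hops H u v"
  then obtain x y where "u = x \<or> {u, x} \<in> H" "x = y \<or> {x, y} \<in> H" "y = v \<or> {y, v} \<in> H"
    unfolding three_hops_def by blast
  then show "three_hops H v u"
    unfolding three_hops_def by (intro exI[of _ y] exI[of _ x]) (auto simp: insert_commute)
qed

lemma three_hops_mono: "three_hops H u v \<Longrightarrow> H \<subseteq> H' \<Longrightarrow> three_hops H' u v"
  unfolding three_hops_def by blast

lemma hop_reachable_refl: "hop_reachable H t u u"
  unfolding hop_reachable_def by (intro exI[of _ "[u]"]) auto

lemma hop_reachable_step:
  assumes "hop_reachable H t v w" and "u = v \<or> {u, v} \<in> H"
  shows "hop_reachable H (Suc t) u w"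
proof -
  obtain ps where ps: "ps \<noteq> []" "length ps \<le> t + 1" "hd ps = v" "last ps = w"
    "\<forall>i. Suc i < length ps \<longrightarrow> {ps ! i, ps ! Suc i} \<in> H"
    using assms(1) unfolding hop_reachable_def by blast
  show ?thesis
  proof (cases "u = v")
    case True
    then show ?thesis using ps unfolding hop_reachable_def by (intro exI[of _ ps]) auto
  next
    case False
    then have "{u, v} \<in> H" using assms(2) by blast
    then have "{(u # ps) ! i, (u # ps) ! Suc i} \<in> H" if "Suc i < length (u # ps)" for i
      using ps that by (cases i) (auto simp: hd_conv_nth)
    then show ?thesis
      using ps unfolding hop_reachable_def by (intro exI[of _ "u # ps"]) auto
  qed
qed

lemma three_hops_imp_hop_reachable:
  assumes "three_hops H u v"
  shows "hop_reachable H 3 u v"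
proof -
  obtain x y where "u = x \<or> {u, x} \<in> H" "x = y \<or> {x, y} \<in> H" "y = v \<or> {y, v} \<in> H"
    using assms unfolding three_hops_def by blast
  then show ?thesis
    unfolding numeral_3_eq_3 by (intro hop_reachable_step[OF hop_reachable_step[OF
          hop_reachable_step[OF hop_reachable_refl]]])
qed

lemma mem_intersection_graph:
  "{u, v} \<in> intersection_graph V Obj \<longleftrightarrow> u \<in> V \<and> v \<in> V \<and> u \<noteq> v \<and> Obj u \<inter> Obj v \<noteq> {}"
  unfolding intersection_graph_def by (auto simp: doubleton_eq_iff)

section \<open>Hub edges at separators and the recursion over rounds\<close>

text \<open>Since \<open>R i\<close> selects at most one member of \<open>F\<close>, each
  \<open>i\<close> contributes at most the \<open>c\<close> points of a single \<open>P X\<close>.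
  This counts both kinds of spanner edges, with \<open>R\<close> being containment in one direction
  or the other.\<close>

lemma card_image_UN_le:
  assumes "finite S" "\<And>X. X \<in> F \<Longrightarrow> finite (P X) \<and> card (P X) \<le> c"
    and "\<And>i X Y. i \<in> S \<Longrightarrow> X \<in> F \<Longrightarrow> Y \<in> F \<Longrightarrow> R i X \<Longrightarrow> R i Y \<Longrightarrow> X = Y"
  shows "finite {f i p | i p. i \<in> S \<and> (\<exists>X\<in>F. R i X \<and> p \<in> P X)}"
    and "card {f i p | i p. i \<in> S \<and> (\<exists>X\<in>F. R i X \<and> p \<in> P X)} \<le> c * card S"
proof -
  define Q where "Q i = {p. \<exists>X\<in>F. R i X \<and> p \<in> P X}" for i
  have Q: "finite (Q i) \<and> card (Q i) \<le> c" if "i \<in> S" for i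
  proof (cases "\<exists>X\<in>F. R i X")
    case True
    then obtain X where X: "X \<in> F" "R i X" by blast
    then have "Q i = P X" using assms(3)[OF that] unfolding Q_def by blast
    then show ?thesis using assms(2)[OF X(1)] by simp
  next
    case False
    then have "Q i = {}" unfolding Q_def by blast
    then show ?thesis by simp
  qed
  have eq: "{f i p | i p. i \<in> S \<and> (\<exists>X\<in>F. R i X \<and> p \<in> P X)} = (\<Union>i\<in>S. f i ` Q i)"
    unfolding Q_def by blast
  show "finite {f i p | i p. i \<in> S \<and> (\<exists>X\<in>F. R i X \<and> p \<in> P X)}"
    unfolding eq using assms(1) Q by blast
  have "card (\<Union>i\<in>S. f i ` Q i) \<le> (\<Sum>i\<in>S. card (f i ` Q i))"
    using assms(1) by (rule card_UN_le)
  also have "\<dots> \<le> (\<Sum>i\<in>S. c)"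
    using Q by (intro sum_mono) (meson card_image_le order_trans)
  finally show "card {f i p | i p. i \<in> S \<and> (\<exists>X\<in>F. R i X \<and> p \<in> P X)} \<le> c * card S"
    unfolding eq by (simp add: mult.commute)
qed

text \<open>One round serves the pairs with a separator between their cells, by the path
  \<open>fst i\<close>, \<open>nb i p\<close>, \<open>hub p\<close>, \<open>fst j\<close>. The first
  edge is a link, the other two belong to a star; \<open>below\<close> bounds the number of links
  and \<open>above\<close> that of star edges.\<close>

lemma separator_spanner:
  fixes S :: "('v \<times> 'a set) set" and Obj :: "'v \<Rightarrow> 'a set"
  assumes fin: "finite S" and V: "fst ` S \<subseteq> V"
    and P: "\<And>X. X \<in> F \<Longrightarrow> finite (P X) \<and> card (P X) \<le> c"
    and hit: "\<And>X j. X \<in> F \<Longrightarrow> j \<in> S \<Longrightarrow> X \<subseteq> snd j \<Longrightarrow> Obj (fst j) \<inter> X \<noteq> {} \<Longrightarrow> P X \<inter> Obj (fst j) \<noteq> {}"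
    and above: "\<And>j X Y. j \<in> S \<Longrightarrow> X \<in> F \<Longrightarrow> Y \<in> F \<Longrightarrow> X \<subseteq> snd j \<Longrightarrow> Y \<subseteq> snd j \<Longrightarrow> X = Y"
    and below: "\<And>j X Y. j \<in> S \<Longrightarrow> X \<in> F \<Longrightarrow> Y \<in> F \<Longrightarrow> snd j \<subseteq> X \<Longrightarrow> snd j \<subseteq> Y \<Longrightarrow> X = Y"
  shows "\<exists>H \<subseteq> intersection_graph V Obj. card H \<le> 2 * c * card S \<and>
    (\<forall>i\<in>S. \<forall>j\<in>S. \<forall>X\<in>F. snd i \<subseteq> X \<longrightarrow> X \<subseteq> snd j \<longrightarrow> Obj (fst i) \<inter> Obj (fst j) \<inter> snd i \<noteq> {} \<longrightarrow>
       three_hops H (fst i) (fst j))"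
proof -
  \<comment> \<open>The centre of a star depends on \<open>p\<close> alone and not on the separator,
    so stars at different separators that share \<open>p\<close> fit together.\<close>
  define hub where "hub p = (SOME v. v \<in> V \<and> p \<in> Obj v)" for p
  \<comment> \<open>The neighbour \<open>w\<close> has to come from an item above a separator that
    owns \<open>p\<close>; this puts the edge from \<open>w\<close> to \<open>hub p\<close> into
    \<open>star\<close>.\<close>
  define good where "good i p w \<longleftrightarrow> p \<in> Obj w \<and> Obj (fst i) \<inter> Obj w \<noteq> {} \<and>
    (\<exists>B. (w, B) \<in> S \<and> (\<exists>X\<in>F. snd i \<subseteq> X \<and> X \<subseteq> B \<and> p \<in> P X))" for i p w
  define nb where "nb i p = (SOME w. good i p w)" for i p
  define star where "star = {{fst j, hub p} | j p. j \<in> S \<and> (\<exists>X\<in>F. X \<subseteq> snd j \<and> p \<in> P X)}"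
  define link where "link = {{fst i, nb i p} | i p. i \<in> S \<and> (\<exists>X\<in>F. snd i \<subseteq> X \<and> p \<in> P X)}"
  define E where "E = intersection_graph V Obj"
  \<comment> \<open>Intersecting with \<open>E\<close> discards singletons, objects that miss
    \<open>p\<close>, and choices of \<open>nb i p\<close> for which no good neighbour
    exists.\<close>
  define H where "H = (star \<union> link) \<inter> E"
  have star: "finite star" "card star \<le> c * card S" unfolding star_def
    by - (rule card_image_UN_le[where F=F and P=P and R="\<lambda>j X. X \<subseteq> snd j"
        and f="\<lambda>j p. {fst j, hub p}"], (fact fin P above)+)+
  have link: "finite link" "card link \<le> c * card S" unfolding link_def
    by - (rule card_image_UN_le[where F=F and P=P and R="\<lambda>i X. snd i \<subseteq> X"
        and f="\<lambda>i p. {fst i, nb i p}"], (fact fin P below)+)+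
  have "card H \<le> card (star \<union> link)" unfolding H_def using star link by (intro card_mono) auto
  also have "\<dots> \<le> card star + card link" by (rule card_Un_le)
  finally have card: "card H \<le> 2 * c * card S" using star(2) link(2) by simp
  have star_hop: "fst j = hub p \<or> {fst j, hub p} \<in> H"
    if "j \<in> S" "X \<in> F" "X \<subseteq> snd j" "p \<in> P X" "p \<in> Obj (fst j)" for j X p
  proof -
    have "hub p \<in> V \<and> p \<in> Obj (hub p)"
      unfolding hub_def by (rule someI[of _ "fst j"]) (use that V in auto)
    then have "fst j = hub p \<or> {fst j, hub p} \<in> E"
      using that V unfolding E_def mem_intersection_graph by blast
    then show ?thesis using that unfolding H_def star_def by blast
  qed
  have "three_hops H (fst i) (fst j)"
    if i: "i \<in> S" and j: "j \<in> S" and X: "X \<in> F" "snd i \<subseteq> X" "X \<subseteq> snd j"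
      and meet: "Obj (fst i) \<inter> Obj (fst j) \<inter> snd i \<noteq> {}" for i j X
  proof -
    obtain p where p: "p \<in> P X" "p \<in> Obj (fst j)" using hit[OF X(1) j X(3)] meet X(2) by blast
    \<comment> \<open>The target itself witnesses that a good neighbour exists; the one selected may
      be another object, but it also contains \<open>p\<close>.\<close>
    have "good i p (fst j)" unfolding good_def using p X meet j by (metis Int_empty_left prod.collapse)
    then have "good i p (nb i p)" unfolding nb_def by (rule someI)
    then obtain B Y where w: "p \<in> Obj (nb i p)" "Obj (fst i) \<inter> Obj (nb i p) \<noteq> {}" "(nb i p, B) \<in> S"
      "Y \<in> F" "snd i \<subseteq> Y" "Y \<subseteq> B" "p \<in> P Y" unfolding good_def by blast
    have "nb i p \<in> V" using w(3) V by force
    then have "fst i = nb i p \<or> {fst i, nb i p} \<in> E"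
      using i V w(2) unfolding E_def mem_intersection_graph by blast
    then have "fst i = nb i p \<or> {fst i, nb i p} \<in> H"
      using i X p unfolding H_def link_def by blast
    moreover have "nb i p = hub p \<or> {nb i p, hub p} \<in> H"
      using star_hop[OF w(3,4)] w by simp
    moreover have "hub p = fst j \<or> {hub p, fst j} \<in> H"
      using star_hop[OF j X(1,3) p] by (metis insert_commute)
    ultimately show ?thesis unfolding three_hops_def by blast
  qed
  moreover have "H \<subseteq> intersection_graph V Obj" unfolding H_def E_def by blast
  ultimately show ?thesis using card by (intro exI[of _ H]) simp
qed

text \<open>The separators for one round are the minimal cells containing at least half of the permitted
  number of items; no item lies above two of them, and they split the remaining nested pairs
  into those strictly below a separator and those not below any.\<close>

lemma laminar_spanner:
  fixes S :: "('v \<times> 'a set) set" and Obj :: "'v \<Rightarrow> 'a set"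
  assumes "finite S" "fst ` S \<subseteq> V"
    and "\<And>i j. i \<in> S \<Longrightarrow> j \<in> S \<Longrightarrow> snd i \<subseteq> snd j \<or> snd j \<subseteq> snd i \<or> snd i \<inter> snd j = {}"
    and "\<And>i. i \<in> S \<Longrightarrow> snd i \<noteq> {}"
    and "\<And>i. i \<in> S \<Longrightarrow> \<exists>P. finite P \<and> card P \<le> c \<and>
      (\<forall>j\<in>S. snd i \<subseteq> snd j \<longrightarrow> Obj (fst j) \<inter> snd i \<noteq> {} \<longrightarrow> P \<inter> Obj (fst j) \<noteq> {})"
    and "\<And>i. i \<in> S \<Longrightarrow> card {j\<in>S. snd j \<subseteq> snd i} < 2 ^ k"
  shows "\<exists>H \<subseteq> intersection_graph V Obj. card H \<le> 2 * c * k * card S \<and>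
    (\<forall>i\<in>S. \<forall>j\<in>S. snd i \<subseteq> snd j \<longrightarrow> Obj (fst i) \<inter> Obj (fst j) \<inter> snd i \<noteq> {} \<longrightarrow>
       three_hops H (fst i) (fst j))"
  using assms
proof (induction k arbitrary: S)
  case 0
  \<comment> \<open>Every item counts itself, so the bound \<open>2 ^ 0\<close> excludes all
    items.\<close>
  have "S = {}"
  proof (rule ccontr)
    assume "S \<noteq> {}"
    then obtain i where "i \<in> S" by blast
    then have "{j\<in>S. snd j \<subseteq> snd i} = {}" using 0(1,6) by simp
    then show False using \<open>i \<in> S\<close> by blast
  qed
  then show ?case by (intro exI[of _ "{}"]) simp
next
  case (Suc k)
  note fin = Suc.prems(1) and V = Suc.prems(2) and lam = Suc.prems(3) and ne = Suc.prems(4)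
    and hit = Suc.prems(5) and small = Suc.prems(6)
  define D where "D X = {j\<in>S. snd j \<subseteq> X}" for X
  have finD: "finite (D X)" for X unfolding D_def using fin by simp
  define big where "big = {X \<in> snd ` S. card (D X) \<ge> 2 ^ k}"
  define F where "F = {X \<in> big. \<forall>Y\<in>big. \<not> Y \<subset> X}"
  have "finite big" unfolding big_def using fin by simp
  have minimal: "\<exists>X\<in>F. X \<subseteq> Y" if "Y \<in> big" for Y
    using finite_has_minimal2[OF \<open>finite big\<close> that] unfolding F_def by blast
  have FS: "F \<subseteq> snd ` S" unfolding F_def big_def by blast
  have disj: "X \<inter> Y = {}" if XY: "X \<in> F" "Y \<in> F" "X \<noteq> Y" for X Y
  proof -
    obtain i j where "i \<in> S" "j \<in> S" "X = snd i" "Y = snd j" using XY FS by blast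
    then show ?thesis using lam[of i j] XY unfolding F_def by blast
  qed
  have below: "X = Y" if "j \<in> S" "X \<in> F" "Y \<in> F" "snd j \<subseteq> X" "snd j \<subseteq> Y" for j X Y
    using disj[OF that(2,3)] ne[OF that(1)] that(4,5) by blast
  have above: "X = Y" if j: "j \<in> S" and XY: "X \<in> F" "Y \<in> F" "X \<subseteq> snd j" "Y \<subseteq> snd j" for j X Y
  proof (rule ccontr)
    assume "X \<noteq> Y"
    \<comment> \<open>Two disjoint families of at least \<open>2 ^ k\<close> items each would
      exhaust the bound \<open>2 ^ Suc k\<close> for the items inside \<open>snd j\<close>.\<close>
    then have "D X \<inter> D Y = {}" using below XY unfolding D_def by blast
    then have "card (D X \<union> D Y) = card (D X) + card (D Y)"
      by (intro card_Un_disjoint finD)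
    moreover have "card (D X \<union> D Y) \<le> card (D (snd j))"
      by (intro card_mono finD) (use XY in \<open>auto simp: D_def\<close>)
    moreover have "card (D X) \<ge> 2 ^ k" "card (D Y) \<ge> 2 ^ k"
      using XY unfolding F_def big_def by auto
    ultimately show False using small[OF j] unfolding D_def by simp
  qed
  have "\<exists>P. finite P \<and> card P \<le> c \<and>
      (\<forall>j\<in>S. X \<subseteq> snd j \<longrightarrow> Obj (fst j) \<inter> X \<noteq> {} \<longrightarrow> P \<inter> Obj (fst j) \<noteq> {})" if "X \<in> F" for X
    using that FS hit by blast
  then obtain P where P: "\<And>X. X \<in> F \<Longrightarrow> finite (P X) \<and> card (P X) \<le> c"
    "\<And>X j. X \<in> F \<Longrightarrow> j \<in> S \<Longrightarrow> X \<subseteq> snd j \<Longrightarrow> Obj (fst j) \<inter> X \<noteq> {} \<Longrightarrow>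
      P X \<inter> Obj (fst j) \<noteq> {}" by metis
  have "\<exists>H \<subseteq> intersection_graph V Obj. card H \<le> 2 * c * card S \<and>
    (\<forall>i\<in>S. \<forall>j\<in>S. \<forall>X\<in>F. snd i \<subseteq> X \<longrightarrow> X \<subseteq> snd j \<longrightarrow> Obj (fst i) \<inter> Obj (fst j) \<inter> snd i \<noteq> {} \<longrightarrow>
       three_hops H (fst i) (fst j))"
    by (rule separator_spanner[where P=P]) (fact fin V P above below)+
  then obtain H0 where H0: "H0 \<subseteq> intersection_graph V Obj" "card H0 \<le> 2 * c * card S"
    "\<forall>i\<in>S. \<forall>j\<in>S. \<forall>X\<in>F. snd i \<subseteq> X \<longrightarrow> X \<subseteq> snd j \<longrightarrow>
      Obj (fst i) \<inter> Obj (fst j) \<inter> snd i \<noteq> {} \<longrightarrow> three_hops H0 (fst i) (fst j)"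
    by (elim exE conjE)
  \<comment> \<open>Items whose cell equals a separator enter neither set: that separator lies
    between the two cells of every nested pair containing such an item.\<close>
  define S1 where "S1 = {j\<in>S. \<exists>X\<in>F. snd j \<subset> X}"
  define S2 where "S2 = {j\<in>S. \<forall>X\<in>F. \<not> snd j \<subseteq> X}"
  have rec: "\<exists>H \<subseteq> intersection_graph V Obj. card H \<le> 2 * c * k * card T \<and>
    (\<forall>i\<in>T. \<forall>j\<in>T. snd i \<subseteq> snd j \<longrightarrow> Obj (fst i) \<inter> Obj (fst j) \<inter> snd i \<noteq> {} \<longrightarrow>
       three_hops H (fst i) (fst j))"
    if T: "T \<subseteq> S" and cT: "\<forall>i\<in>T. card {j\<in>T. snd j \<subseteq> snd i} < 2 ^ k" for T
  proof (rule Suc.IH)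
    show "finite T" using T fin finite_subset by blast
    show "fst ` T \<subseteq> V" using T V by blast
    show "snd i \<subseteq> snd j \<or> snd j \<subseteq> snd i \<or> snd i \<inter> snd j = {}" if "i \<in> T" "j \<in> T" for i j
      using lam T that by blast
    show "snd i \<noteq> {}" if "i \<in> T" for i using ne T that by blast
    show "\<exists>P. finite P \<and> card P \<le> c \<and>
      (\<forall>j\<in>T. snd i \<subseteq> snd j \<longrightarrow> Obj (fst j) \<inter> snd i \<noteq> {} \<longrightarrow> P \<inter> Obj (fst j) \<noteq> {})" if "i \<in> T" for i
      using hit[of i] T that by (meson subsetD)
  qed (use cT in blast)
  have c1: "\<forall>i\<in>S1. card {j\<in>S1. snd j \<subseteq> snd i} < 2 ^ k"
  proof
    fix i assume i: "i \<in> S1"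
    show "card {j\<in>S1. snd j \<subseteq> snd i} < 2 ^ k"
    proof -
      \<comment> \<open>A cell strictly inside a minimal big cell is not big.\<close>
      have "snd i \<notin> big" using i unfolding S1_def F_def by blast
      then have "card (D (snd i)) < 2 ^ k" using i unfolding big_def S1_def by auto
      moreover have "card {j\<in>S1. snd j \<subseteq> snd i} \<le> card (D (snd i))"
        by (intro card_mono finD) (auto simp: D_def S1_def)
      ultimately show ?thesis by simp
    qed
  qed
  have c2: "\<forall>i\<in>S2. card {j\<in>S2. snd j \<subseteq> snd i} < 2 ^ k"
  proof
    fix i assume i: "i \<in> S2"
    show "card {j\<in>S2. snd j \<subseteq> snd i} < 2 ^ k"
    proof (cases "snd i \<in> big")
      case True
      then obtain X where X: "X \<in> F" "X \<subseteq> snd i" using minimal by blast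
      \<comment> \<open>At least \<open>2 ^ k\<close> of the fewer than \<open>2 ^ Suc k\<close>
        items inside \<open>snd i\<close> lie in the separator \<open>X\<close> and hence outside
        \<open>S2\<close>.\<close>
      have "{j\<in>S2. snd j \<subseteq> snd i} \<inter> D X = {}" using X unfolding S2_def D_def by blast
      then have "card ({j\<in>S2. snd j \<subseteq> snd i} \<union> D X) = card {j\<in>S2. snd j \<subseteq> snd i} + card (D X)"
        by (intro card_Un_disjoint finD) (auto simp: S2_def fin)
      moreover have "card ({j\<in>S2. snd j \<subseteq> snd i} \<union> D X) \<le> card (D (snd i))"
        by (intro card_mono finD) (use X in \<open>auto simp: D_def S2_def\<close>)
      moreover have "card (D X) \<ge> 2 ^ k" using X unfolding F_def big_def by auto
      moreover have "card (D (snd i)) < 2 * 2 ^ k" using small[of i] i unfolding D_def S2_def by simp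
      ultimately show ?thesis by simp
    next
      case False
      then have "card (D (snd i)) < 2 ^ k" using i unfolding big_def S2_def by auto
      moreover have "card {j\<in>S2. snd j \<subseteq> snd i} \<le> card (D (snd i))"
        by (intro card_mono finD) (auto simp: D_def S2_def)
      ultimately show ?thesis by simp
    qed
  qed
  have "S1 \<subseteq> S" "S2 \<subseteq> S" unfolding S1_def S2_def by auto
  obtain H1 where H1: "H1 \<subseteq> intersection_graph V Obj" "card H1 \<le> 2 * c * k * card S1"
    "\<forall>i\<in>S1. \<forall>j\<in>S1. snd i \<subseteq> snd j \<longrightarrow> Obj (fst i) \<inter> Obj (fst j) \<inter> snd i \<noteq> {} \<longrightarrow>
       three_hops H1 (fst i) (fst j)"
    using rec[OF \<open>S1 \<subseteq> S\<close> c1] by blast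
  obtain H2 where H2: "H2 \<subseteq> intersection_graph V Obj" "card H2 \<le> 2 * c * k * card S2"
    "\<forall>i\<in>S2. \<forall>j\<in>S2. snd i \<subseteq> snd j \<longrightarrow> Obj (fst i) \<inter> Obj (fst j) \<inter> snd i \<noteq> {} \<longrightarrow>
       three_hops H2 (fst i) (fst j)"
    using rec[OF \<open>S2 \<subseteq> S\<close> c2] by blast
  \<comment> \<open>By disjointness the two recursive bounds add up to at most the bound for
    \<open>S\<close> with \<open>k\<close>, so each level costs only the
    \<open>2 * c * card S\<close> edges of its separators.\<close>
  have "S1 \<inter> S2 = {}" unfolding S1_def S2_def by blast
  then have "card S1 + card S2 = card (S1 \<union> S2)"
    using \<open>S1 \<subseteq> S\<close> \<open>S2 \<subseteq> S\<close> fin by (metis card_Un_disjoint finite_subset)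
  also have "\<dots> \<le> card S" using \<open>S1 \<subseteq> S\<close> \<open>S2 \<subseteq> S\<close> fin by (intro card_mono) auto
  finally have "2 * c * k * (card S1 + card S2) \<le> 2 * c * k * card S" by (rule mult_le_mono2)
  moreover have "card (H0 \<union> H1 \<union> H2) \<le> card H0 + card H1 + card H2"
    using card_Un_le[of "H0 \<union> H1" H2] card_Un_le[of H0 H1] by linarith
  ultimately have card: "card (H0 \<union> H1 \<union> H2) \<le> 2 * c * Suc k * card S"
    using H0(2) H1(2) H2(2) by (simp add: algebra_simps)
  have "three_hops (H0 \<union> H1 \<union> H2) (fst i) (fst j)"
    if i: "i \<in> S" and j: "j \<in> S" and ij: "snd i \<subseteq> snd j"
      and meet: "Obj (fst i) \<inter> Obj (fst j) \<inter> snd i \<noteq> {}" for i j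
  proof -
    consider X where "X \<in> F" "snd i \<subseteq> X" "X \<subseteq> snd j"
      | X where "X \<in> F" "snd i \<subseteq> X" "\<not> X \<subseteq> snd j" | "\<forall>X\<in>F. \<not> snd i \<subseteq> X"
      by blast
    then show ?thesis
    proof cases
      case 1
      have "three_hops H0 (fst i) (fst j)" by (rule H0(3)[rule_format, OF i j 1 meet])
      then show ?thesis by (rule three_hops_mono) blast
    next
      case 2
      obtain l where "l \<in> S" "X = snd l" using 2 FS by blast
      \<comment> \<open>Both \<open>snd j\<close> and \<open>X\<close> contain the nonempty
        \<open>snd i\<close>, so laminarity makes them comparable.\<close>
      then have "snd j \<subset> X" using lam[of j l] j 2 ij ne[OF i] by blast
      then have "i \<in> S1" "j \<in> S1" using i j ij 2 unfolding S1_def by blast+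
      have "three_hops H1 (fst i) (fst j)" by (rule H1(3)[rule_format, OF \<open>i \<in> S1\<close> \<open>j \<in> S1\<close> ij meet])
      then show ?thesis by (rule three_hops_mono) blast
    next
      case 3
      then have "i \<in> S2" "j \<in> S2" using i j ij unfolding S2_def by blast+
      have "three_hops H2 (fst i) (fst j)" by (rule H2(3)[rule_format, OF \<open>i \<in> S2\<close> \<open>j \<in> S2\<close> ij meet])
      then show ?thesis by (rule three_hops_mono) blast
    qed
  qed
  moreover have "H0 \<union> H1 \<union> H2 \<subseteq> intersection_graph V Obj" using H0(1) H1(1) H2(1) by blast
  ultimately show ?case using card by (intro exI[of _ "H0 \<union> H1 \<union> H2"]) simp
qed

section \<open>Dyadic cells as a laminar family\<close>

text \<open>For positive \<open>s\<close> this is the largest power of two that is at most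
  \<open>s\<close>, negative exponents included.\<close>

definition dyadic :: "real \<Rightarrow> real" where
  "dyadic s = 2 powr of_int \<lfloor>log 2 s\<rfloor>"

lemma dyadic_pos: "dyadic s > 0"
  unfolding dyadic_def by simp

lemma dyadic_bounds:
  assumes "s > 0"
  shows "dyadic s \<le> s" "s < 2 * dyadic s"
proof -
  have s: "s = 2 powr log 2 s" using assms by simp
  have "dyadic s \<le> 2 powr log 2 s"
    unfolding dyadic_def by (intro powr_mono) auto
  then show "dyadic s \<le> s" using s by simp
  have "2 powr log 2 s < 2 powr (of_int \<lfloor>log 2 s\<rfloor> + 1)"
    by (intro powr_less_mono) linarith+
  then show "s < 2 * dyadic s" using s unfolding dyadic_def by (simp add: powr_add)
qed

text \<open>The exponents differ by a natural number. Hence the grid for \<open>t\<close> is a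
  coarsening of the grid for \<open>s\<close>.\<close>

lemma dyadic_multiple:
  assumes "0 < s" "s \<le> t"
  obtains m :: int where "dyadic t = dyadic s * of_int m"
proof -
  have "\<lfloor>log 2 s\<rfloor> \<le> \<lfloor>log 2 t\<rfloor>" using assms by (intro floor_mono) simp
  then obtain e :: nat where e: "\<lfloor>log 2 t\<rfloor> = \<lfloor>log 2 s\<rfloor> + int e" by (metis zle_iff_zadd)
  have "dyadic t = dyadic s * 2 powr real e"
    unfolding dyadic_def e by (simp add: powr_add)
  also have "\<dots> = dyadic s * of_int (2 ^ e)"
    by (simp add: powr_realpow)
  finally show ?thesis by (rule that)
qed

text \<open>The case \<open>s = 0\<close> provides for objects that are single points.\<close>

definition cell :: "real \<Rightarrow> real ^ 'd \<Rightarrow> (real ^ 'd) set" where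
  "cell s q = (if s = 0 then {q} else {x. \<forall>i. \<lfloor>x $ i / dyadic s\<rfloor> = \<lfloor>q $ i / dyadic s\<rfloor>})"

lemma self_in_cell: "q \<in> cell s q"
  unfolding cell_def by simp

lemma cell_eqI: "p \<in> cell s q \<Longrightarrow> cell s p = cell s q"
  unfolding cell_def by (auto split: if_splits)

lemma cell_mono:
  assumes "0 \<le> s" "s \<le> t"
  shows "cell s q \<subseteq> cell t q"
proof (cases "s = 0")
  case True
  then show ?thesis using self_in_cell[of q t] by (simp add: cell_def)
next
  case False
  then obtain m :: int where m: "dyadic t = dyadic s * of_int m"
    using dyadic_multiple[of s t] assms by force
  \<comment> \<open>The coarse grid index is a function of the fine one, so points agreeing on the
    fine index agree on the coarse one.\<close>
  have "\<lfloor>y / dyadic t\<rfloor> = \<lfloor>y / dyadic s\<rfloor> div m" for y :: real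
    unfolding m using floor_divide_real_eq_div[of m "y / dyadic s"] dyadic_pos[of s] dyadic_pos[of t] m
    by (simp add: zero_less_mult_iff)
  then show ?thesis using False assms unfolding cell_def by auto
qed

text \<open>A common point can replace both \<open>p\<close> and \<open>q\<close> as reference
  point, after which \<open>cell_mono\<close> compares the cells.\<close>

lemma cell_nested:
  assumes "0 \<le> s" "0 \<le> t"
  shows "cell s p \<subseteq> cell t q \<or> cell t q \<subseteq> cell s p \<or> cell s p \<inter> cell t q = {}"
proof -
  have "cell s p \<subseteq> cell t q \<or> cell t q \<subseteq> cell s p" if x: "x \<in> cell s p" "x \<in> cell t q" for x
    using cell_mono[of s t x] cell_mono[of t s x] assms cell_eqI[OF x(1)] cell_eqI[OF x(2)]
    by (cases "s \<le> t") auto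
  then show ?thesis by blast
qed

lemma cell_extent:
  assumes "0 \<le> s" "x \<in> cell s q" "y \<in> cell s q"
  shows "x $ i - y $ i \<le> s"
proof (cases "s = 0")
  case True
  then show ?thesis using assms by (simp add: cell_def)
next
  case False
  then have "\<lfloor>x $ i / dyadic s\<rfloor> = \<lfloor>y $ i / dyadic s\<rfloor>" using assms by (simp add: cell_def)
  then have "x $ i / dyadic s - y $ i / dyadic s \<le> 1" by linarith
  then have "x $ i - y $ i \<le> dyadic s"
    using dyadic_pos[of s] by (simp add: diff_divide_distrib[symmetric] pos_divide_le_eq)
  then show ?thesis using dyadic_bounds(1)[of s] False assms(1) by simp
qed

text \<open>Prepares the use of fatness at a cell: the last conjunct turns containment of cells into
  the lower bound on side length that \<open>c_fat\<close> demands. A single point gets the cube of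
  side \<open>0\<close>.\<close>

lemma cell_in_hypercube:
  fixes q :: "real ^ 'd"
  shows "\<exists>a l. l \<ge> 0 \<and> cell s q \<subseteq> hypercube a l \<and>
    (\<forall>t p. 0 \<le> t \<longrightarrow> cell s q \<subseteq> cell t p \<longrightarrow> l \<le> t)"
proof (cases "s = 0")
  case True
  then have "cell s q \<subseteq> hypercube q 0" by (simp add: cell_def hypercube_def)
  then show ?thesis by (intro exI[of _ q] exI[of _ 0]) simp
next
  case False
  define r where "r = dyadic s"
  have r: "r > 0" unfolding r_def by (rule dyadic_pos)
  define a :: "real ^ 'd" where "a = (\<chi> i. r * of_int \<lfloor>q $ i / r\<rfloor>)"
  have cell: "cell s q = {x. \<forall>i. a $ i \<le> x $ i \<and> x $ i < a $ i + r}"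
    using False r unfolding cell_def r_def[symmetric] a_def
    by (simp add: floor_eq_iff pos_le_divide_eq pos_divide_less_eq algebra_simps)
  show ?thesis
  proof (intro exI conjI allI impI)
    show "r \<ge> 0" using r by simp
    show "cell s q \<subseteq> hypercube a r" unfolding cell hypercube_def by (auto intro: less_imp_le)
    fix t p assume t: "0 \<le> t" and sub: "cell s q \<subseteq> cell t p"
    show "r \<le> t"
    \<comment> \<open>The cell is half-open and does not attain the extent \<open>r\<close>, so the
      bound is shown for \<open>z * r\<close> with every \<open>z < 1\<close>.\<close>
    proof (rule field_le_mult_one_interval)
      fix z :: real assume z: "0 < z" "z < 1"
      define b :: "real ^ 'd" where "b = (\<chi> i. a $ i + z * r)"
      have "a \<in> cell s q" "b \<in> cell s q" unfolding cell b_def using r z by auto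
      then have "b $ i - a $ i \<le> t" for i by (intro cell_extent[OF t, of _ p] subsetD[OF sub])
      then show "z * r \<le> t" unfolding b_def by simp
    qed
  qed
qed

section \<open>Number of cells per object\<close>

lemma side_length_extent:
  fixes S :: "(real ^ 'd) set"
  assumes "bounded S" "S \<noteq> {}"
  shows "x \<in> S \<Longrightarrow> (INF x\<in>S. x $ i) \<le> x $ i"
    and "x \<in> S \<Longrightarrow> x $ i \<le> (INF x\<in>S. x $ i) + side_length S"
    and "0 \<le> side_length S"
proof -
  have "bounded ((\<lambda>x. x $ i) ` S)" for i
    using assms(1) by (rule bounded_component_cart)
  then have bdd: "bdd_below ((\<lambda>x. x $ i) ` S)" "bdd_above ((\<lambda>x. x $ i) ` S)" for i
    by (auto intro: bounded_imp_bdd_below bounded_imp_bdd_above)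
  show low: "(INF x\<in>S. x $ i) \<le> x $ i" if "x \<in> S" for x i
    using cINF_lower[OF bdd(1) that] .
  have side: "(SUP x\<in>S. x $ i) - (INF x\<in>S. x $ i) \<le> side_length S" for i
    unfolding side_length_def by (rule Max_ge) auto
  show up: "x $ i \<le> (INF x\<in>S. x $ i) + side_length S" if "x \<in> S" for x i
    using cSUP_upper[OF that bdd(2)[of i]] side[of i] by linarith
  obtain x where x: "x \<in> S" using assms(2) by blast
  \<comment> \<open>Here \<open>undefined\<close> is just some coordinate.\<close>
  show "0 \<le> side_length S" using low[OF x, of undefined] up[OF x, of undefined] by linarith
qed

text \<open>In each coordinate the object spans less than two grid widths, so its grid index exceeds
  that of the infimum by \<open>0\<close>, \<open>1\<close> or \<open>2\<close>. With side length
  \<open>0\<close> the object is one point and has one cell.\<close>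

lemma card_cells_le:
  fixes S :: "(real ^ 'd) set"
  assumes "bounded S" "S \<noteq> {}"
  shows "finite (cell (side_length S) ` S)" "card (cell (side_length S) ` S) \<le> 3 ^ CARD('d)"
proof -
  define s where "s = side_length S"
  define l where "l i = (INF x\<in>S. x $ i)" for i
  have ext: "l i \<le> x $ i" "x $ i \<le> l i + s" if "x \<in> S" for x i
    unfolding l_def s_def using side_length_extent(1,2)[OF assms that] by simp_all
  have "finite (cell s ` S) \<and> card (cell s ` S) \<le> 3 ^ CARD('d)"
  proof (cases "s = 0")
    case True
    have "x $ i = l i" if "x \<in> S" for x i
      using ext[OF that, of i] True by linarith
    then have "x = y" if "x \<in> S" "y \<in> S" for x y
      using that by (simp add: vec_eq_iff)
    then obtain q where "S = {q}" using assms(2) by blast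
    then show ?thesis by simp
  next
    case False
    then have s: "s > 0" using side_length_extent(3)[OF assms] unfolding s_def by simp
    define r where "r = dyadic s"
    have r: "r > 0" "s < 2 * r" unfolding r_def using dyadic_pos dyadic_bounds[OF s] by auto
    define B where "B = (UNIV :: 'd set) \<rightarrow>\<^sub>E {0..2::int}"
    define g where "g f = {x :: real ^ 'd. \<forall>i. \<lfloor>x $ i / r\<rfloor> = \<lfloor>l i / r\<rfloor> + f i}" for f
    have B: "finite B" "card B = 3 ^ CARD('d)"
      unfolding B_def by (auto intro!: finite_PiE simp: card_PiE)
    have "cell s ` S \<subseteq> g ` B"
    proof
      fix X assume "X \<in> cell s ` S"
      then obtain q where q: "q \<in> S" "X = cell s q" by blast
      define f where "f i = \<lfloor>q $ i / r\<rfloor> - \<lfloor>l i / r\<rfloor>" for i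
      have "0 \<le> f i \<and> f i \<le> 2" for i
      proof -
        have "l i / r \<le> q $ i / r" using ext[OF q(1)] r by (simp add: divide_right_mono)
        moreover have "q $ i < l i + 2 * r" using ext(2)[OF q(1), of i] r by linarith
        then have "q $ i / r < l i / r + 2" using r by (simp add: field_simps)
        ultimately show ?thesis unfolding f_def by linarith
      qed
      then have "f \<in> B" unfolding B_def by auto
      moreover have "X = g f" using False unfolding q(2) cell_def g_def f_def r_def by simp
      ultimately show "X \<in> g ` B" by blast
    qed
    then have "finite (cell s ` S)" "card (cell s ` S) \<le> card B"
      using finite_surj[OF B(1)] surj_card_le[OF B(1)] by simp_all
    then show ?thesis using B(2) by simp
  qed
  then show "finite (cell (side_length S) ` S)" "card (cell (side_length S) ` S) \<le> 3 ^ CARD('d)"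
    unfolding s_def by simp_all
qed

section \<open>Size bound and spanner for a fat collection\<close>

theorem theorem11:
  fixes c :: nat
  assumes "c \<ge> 1"
  shows "\<exists>C::real. \<forall>(V::nat set) (Obj::nat \<Rightarrow> (real ^ 'd) set).
           finite V \<longrightarrow> (\<forall>v\<in>V. bounded (Obj v) \<and> Obj v \<noteq> {}) \<longrightarrow> c_fat c V Obj \<longrightarrow>
           (\<exists>H. hop_spanner (intersection_graph V Obj) H 3 \<and>
                real (card H) \<le> C * real (card V) * ln (real (card V)))"
proof (rule exI[of _ "4 * real c * 3 ^ CARD('d) * (1 + real CARD('d)) / ln 2"], intro allI impI)
  fix V :: "nat set" and Obj :: "nat \<Rightarrow> (real ^ 'd) set"
  define d where "d = CARD('d)"
  define E where "E = intersection_graph V Obj"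
  assume finV: "finite V" and obj: "\<forall>v\<in>V. bounded (Obj v) \<and> Obj v \<noteq> {}" and fat: "c_fat c V Obj"
  define n where "n = card V"
  define side where "side v = side_length (Obj v)" for v
  define S where "S = (SIGMA v:V. cell (side v) ` Obj v)"
  have side: "0 \<le> side v" if "v \<in> V" for v
    unfolding side_def using side_length_extent(3)[of "Obj v"] obj that by simp
  have cells: "finite (cell (side v) ` Obj v) \<and> card (cell (side v) ` Obj v) \<le> 3 ^ d" if "v \<in> V" for v
    unfolding side_def d_def using card_cells_le[of "Obj v"] obj that by simp
  have finS: "finite S" unfolding S_def using finV cells by blast
  have "card S = (\<Sum>v\<in>V. card (cell (side v) ` Obj v))"
    unfolding S_def using finV cells by (intro card_SigmaI) auto
  also have "\<dots> \<le> (\<Sum>v\<in>V. 3 ^ d)" using cells by (intro sum_mono) blast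
  finally have cardS: "card S \<le> n * 3 ^ d" unfolding n_def by simp
  have in_S: "\<exists>v\<in>V. \<exists>q\<in>Obj v. i = (v, cell (side v) q)" if "i \<in> S" for i
    using that unfolding S_def by blast
  have "\<exists>H \<subseteq> E. real (card H) \<le>
      4 * real c * 3 ^ d * (1 + real d) / ln 2 * real n * ln (real n) \<and>
      (\<forall>i\<in>S. \<forall>j\<in>S. fst i \<noteq> fst j \<longrightarrow> snd i \<subseteq> snd j \<longrightarrow> Obj (fst i) \<inter> Obj (fst j) \<inter> snd i \<noteq> {} \<longrightarrow>
        three_hops H (fst i) (fst j))"
  \<comment> \<open>For \<open>n \<le> 1\<close> the bound is \<open>0\<close>, by the factor
    \<open>real n\<close> or by \<open>ln 1 = 0\<close>, and only the empty edge set
    qualifies.\<close>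
  proof (cases "n \<le> 1")
    case True
    then have "u = v" if "u \<in> V" "v \<in> V" for u v
      using that finV card_le_Suc0_iff_eq[of V] unfolding n_def by simp
    then have same: "fst i = fst j" if "i \<in> S" "j \<in> S" for i j
      using that unfolding S_def by auto
    have "n = 0 \<or> n = 1" using True by linarith
    then have "real (card {}) \<le>
        4 * real c * 3 ^ d * (1 + real d) / ln 2 * real n * ln (real n)" by auto
    then show ?thesis using same by (intro exI[of _ "{}"] conjI ballI impI) blast+
  next
    case False
    then have n: "real n \<ge> 2" by simp
    define m where "m = nat \<lceil>log 2 (real n)\<rceil>"
    \<comment> \<open>The part \<open>m\<close> accounts for the factor \<open>n\<close> in the
      bound on \<open>card S\<close>, and \<open>2 * d\<close> for \<open>3 ^ d < 4 ^ d\<close>,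
      which also makes the inequality strict.\<close>
    define k where "k = m + 2 * d"
    have log: "log 2 (real n) \<ge> 1" using n by simp
    then have m: "log 2 (real n) \<le> real m" "real m \<le> log 2 (real n) + 1" unfolding m_def by linarith+
    have "real n = 2 powr log 2 (real n)" using n by simp
    also have "\<dots> \<le> 2 powr real m" using m by (intro powr_mono) auto
    finally have "real n \<le> real (2 ^ m)" by (simp add: powr_realpow)
    then have "n \<le> 2 ^ m" using of_nat_le_iff by blast
    moreover have "(3::nat) ^ d < 4 ^ d" unfolding d_def by (intro power_strict_mono) auto
    ultimately have "n * 3 ^ d < 2 ^ m * 4 ^ d" using False by (intro mult_le_less_imp_less) auto
    also have "(2::nat) ^ m * 4 ^ d = 2 ^ k" unfolding k_def by (simp add: power_add power_mult)
    finally have cardS_k: "card S < 2 ^ k" using cardS by simp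
    \<comment> \<open>As \<open>log 2 (real n) \<ge> 1\<close>, the additive terms \<open>1\<close>
      and \<open>2 * d\<close> in \<open>k\<close> are absorbed into multiples of the
      logarithm.\<close>
    have "real d * 1 \<le> real d * log 2 (real n)" using log by (intro mult_left_mono) auto
    then have k: "real k \<le> 2 * (1 + real d) * log 2 (real n)"
      unfolding k_def using m log by (simp add: algebra_simps)
    have "\<exists>H \<subseteq> E. card H \<le> 2 * c * k * card S \<and>
      (\<forall>i\<in>S. \<forall>j\<in>S. snd i \<subseteq> snd j \<longrightarrow> Obj (fst i) \<inter> Obj (fst j) \<inter> snd i \<noteq> {} \<longrightarrow>
         three_hops H (fst i) (fst j))"
      unfolding E_def
    proof (rule laminar_spanner[OF finS])
      show "fst ` S \<subseteq> V" unfolding S_def by auto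
      show "snd i \<subseteq> snd j \<or> snd j \<subseteq> snd i \<or> snd i \<inter> snd j = {}" if ij: "i \<in> S" "j \<in> S" for i j
      proof -
        obtain u p v q where "u \<in> V" "i = (u, cell (side u) p)" "v \<in> V" "j = (v, cell (side v) q)"
          using in_S[OF ij(1)] in_S[OF ij(2)] by blast
        then show ?thesis using cell_nested[OF side side] by simp
      qed
      show "snd i \<noteq> {}" if "i \<in> S" for i using in_S[OF that] self_in_cell by (metis empty_iff snd_conv)
      show "\<exists>P. finite P \<and> card P \<le> c \<and>
        (\<forall>j\<in>S. snd i \<subseteq> snd j \<longrightarrow> Obj (fst j) \<inter> snd i \<noteq> {} \<longrightarrow> P \<inter> Obj (fst j) \<noteq> {})" if "i \<in> S" for i
      proof -
        obtain u q where i: "i = (u, cell (side u) q)" using in_S[OF \<open>i \<in> S\<close>] by blast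
        have "snd i = cell (side u) q" using i by simp
        then obtain a l where l: "l \<ge> 0" "snd i \<subseteq> hypercube a l"
          "\<forall>t p. 0 \<le> t \<longrightarrow> snd i \<subseteq> cell t p \<longrightarrow> l \<le> t"
          using cell_in_hypercube[of "side u" q] by (elim exE conjE) simp
        have "\<exists>P. finite P \<and> card P \<le> c \<and>
          (\<forall>v\<in>V. Obj v \<inter> hypercube a l \<noteq> {} \<and> side v \<ge> l \<longrightarrow> P \<inter> Obj v \<noteq> {})"
          using fat l(1) unfolding c_fat_def side_def by simp
        then obtain P where P: "finite P" "card P \<le> c"
          "\<forall>v\<in>V. Obj v \<inter> hypercube a l \<noteq> {} \<and> side v \<ge> l \<longrightarrow> P \<inter> Obj v \<noteq> {}"
          by (elim exE conjE)
        \<comment> \<open>Containment of the cells makes the object large enough for the cube, and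
          meeting the inner cell makes it meet the cube.\<close>
        have "P \<inter> Obj (fst j) \<noteq> {}" if j: "j \<in> S" "snd i \<subseteq> snd j" "Obj (fst j) \<inter> snd i \<noteq> {}" for j
        proof -
          obtain v p where v: "v \<in> V" "j = (v, cell (side v) p)" using in_S[OF j(1)] by blast
          then have "snd i \<subseteq> cell (side v) p" using j(2) by simp
          then have "l \<le> side v" by (rule l(3)[rule_format, OF side[OF v(1)]])
          moreover have "Obj v \<inter> hypercube a l \<noteq> {}" using v j(3) l(2) by auto
          ultimately show ?thesis using P(3) v by simp
        qed
        then show ?thesis using P(1,2) by blast
      qed
      show "card {j\<in>S. snd j \<subseteq> snd i} < 2 ^ k" for i
        using card_mono[OF finS, of "{j\<in>S. snd j \<subseteq> snd i}"] cardS_k by simp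
    qed
    then obtain H where H: "H \<subseteq> E" "card H \<le> 2 * c * k * card S"
      "\<forall>i\<in>S. \<forall>j\<in>S. snd i \<subseteq> snd j \<longrightarrow> Obj (fst i) \<inter> Obj (fst j) \<inter> snd i \<noteq> {} \<longrightarrow>
         three_hops H (fst i) (fst j)" by (elim exE conjE)
    \<comment> \<open>The constant of the theorem arises here: \<open>2 * c\<close> edges per item
      and round, \<open>3 ^ d\<close> items per object, \<open>2 * (1 + d)\<close> from
      \<open>k\<close>, and \<open>ln 2\<close> from the change of base.\<close>
    have "card H \<le> 2 * c * k * (n * 3 ^ d)" using H(2) cardS by (meson mult_le_mono2 order_trans)
    then have "real (card H) \<le> real (2 * c * k * (n * 3 ^ d))" by (rule of_nat_mono)
    also have "\<dots> = 2 * real c * real n * 3 ^ d * real k" by simp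
    also have "\<dots> \<le> 2 * real c * real n * 3 ^ d * (2 * (1 + real d) * log 2 (real n))"
      using k by (intro mult_left_mono) auto
    also have "\<dots> = 4 * real c * 3 ^ d * (1 + real d) / ln 2 * real n * ln (real n)"
      by (simp add: log_def)
    finally show ?thesis using H(1,3) by (intro exI[of _ H]) simp
  qed
  then obtain H where H: "H \<subseteq> E"
    "real (card H) \<le> 4 * real c * 3 ^ d * (1 + real d) / ln 2 * real n * ln (real n)"
    "\<forall>i\<in>S. \<forall>j\<in>S. fst i \<noteq> fst j \<longrightarrow> snd i \<subseteq> snd j \<longrightarrow> Obj (fst i) \<inter> Obj (fst j) \<inter> snd i \<noteq> {} \<longrightarrow>
        three_hops H (fst i) (fst j)" by (elim exE conjE)
  have hops: "three_hops H u v" if "{u, v} \<in> E" for u v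
  proof -
    obtain q where uv: "u \<in> V" "v \<in> V" "u \<noteq> v" "q \<in> Obj u" "q \<in> Obj v"
      using \<open>{u, v} \<in> E\<close> unfolding E_def mem_intersection_graph by blast
    \<comment> \<open>Both cells are taken around the common point \<open>q\<close>; with the
      smaller object first they are nested, and \<open>q\<close> is the required meeting point in
      the inner cell.\<close>
    have nested: "three_hops H x y"
      if "x \<in> V" "y \<in> V" "x \<noteq> y" "q \<in> Obj x" "q \<in> Obj y" "side x \<le> side y" for x y
    proof -
      have "(x, cell (side x) q) \<in> S" "(y, cell (side y) q) \<in> S" using that unfolding S_def by auto
      moreover have "cell (side x) q \<subseteq> cell (side y) q" using that side by (intro cell_mono)
      moreover have "q \<in> Obj x \<inter> Obj y \<inter> cell (side x) q" using that self_in_cell by auto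
      ultimately show ?thesis using H(3) \<open>x \<noteq> y\<close> by (metis empty_iff fst_conv snd_conv)
    qed
    show ?thesis
    proof (cases "side u \<le> side v")
      case True
      then show ?thesis by (intro nested uv)
    next
      case False
      then have "three_hops H v u" by (intro nested uv uv(3)[symmetric]) simp
      then show ?thesis by (rule three_hops_sym)
    qed
  qed
  have "hop_spanner E H 3"
    unfolding hop_spanner_def by (intro conjI allI impI H(1) three_hops_imp_hop_reachable hops)
  then show "\<exists>H. hop_spanner (intersection_graph V Obj) H 3 \<and> real (card H) \<le>
      4 * real c * 3 ^ CARD('d) * (1 + real CARD('d)) / ln 2 * real (card V) * ln (real (card V))"
    using H(2) unfolding E_def n_def d_def by (intro exI[of _ H] conjI)
qed

end
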